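(* Consider the problem (stochastic program II) of minimizing, over all admissible control policies $\pi=\{(G_i,C_i,D_i): i=1,2,\ldots\}$, the cost $$J_L(\pi,S_1)=\limsup_{n\to\infty}\mathbb{E}\Big[\frac1n\sum_{i=1}^n 1_{\{\Delta_i<-G_{\max}-\alpha_d S_i\}}\Big]$$ where $\Delta_1,\Delta_2,\ldots$ is an arbitrary random process. Then the following stationary policy $\pi^{(2)}=\{(G^{(2)}_i,C^{(2)}_i,D^{(2)}_i)\}$ is optimal, i.e. $J_L(\pi^{(2)},S_1)\le J_L(\pi,S_1)$ for every admissible policy $\pi$: - if $\frac{S_{\max}-S_i}{\alpha_c}\le \Delta_i$: $G_i=0$, $C_i=\frac{S_{\max}-S_i}{\alpha_c}$, $D_i=0$ (so $S_{i+1}=S_{\max}$); - if $-G_{\max}+\frac{S_{\max}-S_i}{\alpha_c}\le\Delta_i<\frac{S_{\max}-S_i}{\alpha_c}$: $G_i=\frac{S_{\max}-S_i}{\alpha_c}-\Delta_i$, $C_i=\frac{S_{\max}-S_i}{\alpha_c}$, $D_i=0$ (so $S_{i+1}=S_{\max}$); - if $-G_{\max}\le\Delta_i<-G_{\max}+\frac{S_{\max}-S_i}{\alpha_c}$: $G_i=G_{\max}$, $C_i=G_{\max}+\Delta_i$, $D_i=0$ (so $S_{i+1}=S_i+\alpha_c(G_{\max}+\Delta_i)$); - if $-G_{\max}-\alpha_d S_i\le\Delta_i<-G_{\max}$: $G_i=G_{\max}$, $C_i=0$, $D_i=-\Delta_i-G_{\max}$ (so $S_{i+1}=S_i+(G_{\max}+\Delta_i)/\alpha_d$);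 - if $\Delta_i<-G_{\max}-\alpha_d S_i$: $G_i=G_{\max}$, $C_i=0$, $D_i=\alpha_d S_i$ (so $S_{i+1}=0$).
   Context: Single-bus power system with storage in slotted time $i=1,2,\ldots$. Constants: charging efficiency $\alpha_c\in(0,1)$, discharging efficiency $\alpha_d\in(0,1)$, conventional generation capacity $G_{\max}\ge 0$, power storage capacity $S_{\max}\ge 0$. The net renewable generation $\Delta_1,\Delta_2,\ldots$ is an exogenous real-valued random process (its law is not affected by the controls). The initial stored power $S_1\in[0,S_{\max}]$ is given. The controls in slot $i$ are the conventional generation $G_i$, the charging power $C_i$ and the discharging power $D_i$. An admissible policy $\pi=\{(G_i,C_i,D_i)\}_{i\ge1}$ chooses $(G_i,C_i,D_i)$ as a (measurable) function of the history $H_i=(S_1,\Delta_1,\ldots,S_{i-1},\Delta_{i-1},S_i)$ and the current $\Delta_i$, such that for all $i$: $$S_{i+1}=S_i+\alpha_c C_i-\frac1{\alpha_d}D_i,\quad 0\le S_i\le S_{\max},\quad C_i\ge0,\quad D_i\ge 0,\quad 0\le G_i\le G_{\max},$$ $$0\le G_i-C_i+D_i+\max\{\Delta_i,-G_{\max}-\alpha_d S_i\}.$$ Charging and discharging rates are otherwise unconstrained. *)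

theory Defs
  imports "HOL-Probability.Probability"
begin

text \<open>
  Slots are numbered 1, 2, ...; the value of a process at index 0 is never used.
  The argument lists use \<open>ac\<close>, \<open>ad\<close> for the charging and discharging efficiencies, \<open>Gmax\<close>, \<open>Smax\<close>
  for the generation and storage capacities, \<open>s1\<close> for the initial stored power, and
  \<open>\<delta> :: nat \<Rightarrow> real\<close> for one realization of the net renewable generation.

  A policy maps a slot \<open>i\<close>, the stored powers of slots 1 to \<open>i\<close> and the net generation of slots
  1 to \<open>i\<close> to the controls \<open>(G, C, D)\<close> of slot \<open>i\<close>. It is only ever applied to
  functions restricted to \<open>{1..i}\<close>, so it cannot depend on the future.
\<close>

type_synonym policy = "nat \<Rightarrow> (nat \<Rightarrow> real) \<Rightarrow> (nat \<Rightarrow> real) \<Rightarrow> real \<times> real \<times> real"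

lemma restrict_fundef_cong [fundef_cong]:
  "A = B \<Longrightarrow> (\<And>x. x \<in> B \<Longrightarrow> f x = g x) \<Longrightarrow> restrict f A = restrict g B"
  by (auto simp: restrict_def)

function stored :: "real \<Rightarrow> real \<Rightarrow> real \<Rightarrow> policy \<Rightarrow> (nat \<Rightarrow> real) \<Rightarrow> nat \<Rightarrow> real" where
  "stored ac ad s1 \<pi> \<delta> i =
     (if i \<le> 1 then s1
      else (case \<pi> (i - 1) (\<lambda>j\<in>{1..i - 1}. stored ac ad s1 \<pi> \<delta> j) (\<lambda>j\<in>{1..i - 1}. \<delta> j) of
              (G, C, D) \<Rightarrow> stored ac ad s1 \<pi> \<delta> (i - 1) + ac * C - (1 / ad) * D))"
  by pat_completeness auto
termination
  by (relation "Wellfounded.measure (\<lambda>(ac, ad, s1, \<pi>, \<delta>, i). i)") auto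

declare stored.simps [simp del]

definition controls ::
  "real \<Rightarrow> real \<Rightarrow> real \<Rightarrow> policy \<Rightarrow> (nat \<Rightarrow> real) \<Rightarrow> nat \<Rightarrow> real \<times> real \<times> real" where
  "controls ac ad s1 \<pi> \<delta> i =
     \<pi> i (\<lambda>j\<in>{1..i}. stored ac ad s1 \<pi> \<delta> j) (\<lambda>j\<in>{1..i}. \<delta> j)"

lemma stored_1: "stored ac ad s1 \<pi> \<delta> 1 = s1"
  by (simp add: stored.simps)

lemma stored_Suc:
  assumes "i \<ge> 1"
  shows "stored ac ad s1 \<pi> \<delta> (Suc i) =
     (case controls ac ad s1 \<pi> \<delta> i of
        (G, C, D) \<Rightarrow> stored ac ad s1 \<pi> \<delta> i + ac * C - (1 / ad) * D)"
  using assms by (subst stored.simps) (simp add: controls_def)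

definition slot_feasible ::
  "real \<Rightarrow> real \<Rightarrow> real \<Rightarrow> real \<Rightarrow> real \<Rightarrow> real \<times> real \<times> real \<Rightarrow> bool" where
  "slot_feasible ad Gmax Smax s d = (\<lambda>(G, C, D).
     0 \<le> s \<and> s \<le> Smax \<and> 0 \<le> C \<and> 0 \<le> D \<and> 0 \<le> G \<and> G \<le> Gmax \<and>
     0 \<le> G - C + D + max d (- Gmax - ad * s))"

definition admissible ::
  "'w measure \<Rightarrow> (nat \<Rightarrow> 'w \<Rightarrow> real) \<Rightarrow> real \<Rightarrow> real \<Rightarrow> real \<Rightarrow> real \<Rightarrow> real \<Rightarrow> policy \<Rightarrow> bool" where
  "admissible M \<Delta> ac ad Gmax Smax s1 \<pi> \<longleftrightarrow>
     (\<forall>i\<ge>1. (\<lambda>(s, d). \<pi> i s d)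
        \<in> borel_measurable ((\<Pi>\<^sub>M j\<in>{1..i}. borel) \<Otimes>\<^sub>M (\<Pi>\<^sub>M j\<in>{1..i}. borel))) \<and>
     (AE \<omega> in M. \<forall>i\<ge>1.
        slot_feasible ad Gmax Smax (stored ac ad s1 \<pi> (\<lambda>j. \<Delta> j \<omega>) i) (\<Delta> i \<omega>)
          (controls ac ad s1 \<pi> (\<lambda>j. \<Delta> j \<omega>) i))"

definition J_L ::
  "'w measure \<Rightarrow> (nat \<Rightarrow> 'w \<Rightarrow> real) \<Rightarrow> real \<Rightarrow> real \<Rightarrow> real \<Rightarrow> policy \<Rightarrow> real \<Rightarrow> ereal" where
  "J_L M \<Delta> ac ad Gmax \<pi> s1 =
     limsup (\<lambda>n. ereal (\<integral>\<omega>. (1 / real n) * (\<Sum>i=1..n.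
        of_bool (\<Delta> i \<omega> < - Gmax - ad * stored ac ad s1 \<pi> (\<lambda>j. \<Delta> j \<omega>) i)) \<partial>M))"

definition stationary :: "(real \<Rightarrow> real \<Rightarrow> real \<times> real \<times> real) \<Rightarrow> policy" where
  "stationary f = (\<lambda>i s d. f (s i) (d i))"

definition pi2_rule ::
  "real \<Rightarrow> real \<Rightarrow> real \<Rightarrow> real \<Rightarrow> real \<Rightarrow> real \<Rightarrow> real \<times> real \<times> real" where
  "pi2_rule ac ad Gmax Smax s d =
     (if (Smax - s) / ac \<le> d then (0, (Smax - s) / ac, 0)
      else if - Gmax + (Smax - s) / ac \<le> d then ((Smax - s) / ac - d, (Smax - s) / ac, 0)
      else if - Gmax \<le> d then (Gmax, Gmax + d, 0)
      else if - Gmax - ad * s \<le> d then (Gmax, 0, - d - Gmax)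
      else (Gmax, 0, ad * s))"

definition pi2 :: "real \<Rightarrow> real \<Rightarrow> real \<Rightarrow> real \<Rightarrow> policy" where
  "pi2 ac ad Gmax Smax = stationary (pi2_rule ac ad Gmax Smax)"

text \<open>The stored power in the next slot, as asserted case by case for \<open>pi2\<close>.\<close>

definition pi2_next ::
  "real \<Rightarrow> real \<Rightarrow> real \<Rightarrow> real \<Rightarrow> real \<Rightarrow> real \<Rightarrow> real" where
  "pi2_next ac ad Gmax Smax s d =
     (if (Smax - s) / ac \<le> d then Smax
      else if - Gmax + (Smax - s) / ac \<le> d then Smax
      else if - Gmax \<le> d then s + ac * (Gmax + d)
      else if - Gmax - ad * s \<le> d then s + (Gmax + d) / ad
      else 0)"

end

theory Submission
  imports Defs
begin

text \<open>
  The stored power under \<open>pi2\<close> dominates, realization by realization, the one under any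
  admissible policy. Because both efficiencies are below 1, charging and discharging at once never
  pays, so \<open>pi2_next\<close> bounds the next stored power of every feasible choice; it is
  monotone in the stored power, hence the bound propagates. Slots with loss of load do not break it,
  because there feasibility forces every policy to empty the storage. Since loss of load is antitone
  in the stored power, \<open>pi2\<close> loses load only in slots in which every other policy does.
\<close>

section \<open>One slot: feasibility, monotonicity and maximality of \<open>pi2_rule\<close>\<close>

lemma pi2_rule_next:
  assumes "0 < ac" "0 < ad"
  shows "(case pi2_rule ac ad Gmax Smax s d of (G, C, D) \<Rightarrow> s + ac * C - (1 / ad) * D)
    = pi2_next ac ad Gmax Smax s d"
  using assms by (auto simp: pi2_rule_def pi2_next_def field_simps)

text \<open>The power balance is tight in every branch except the first, whose slack is the surplus
  left after filling the storage.\<close>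

lemma pi2_rule_feasible:
  assumes "0 < ac" "0 < ad" "0 \<le> Gmax" "0 \<le> s" "s \<le> Smax"
  shows "slot_feasible ad Gmax Smax s d (pi2_rule ac ad Gmax Smax s d)"
proof -
  \<comment> \<open>With these signs, the maximum in the balance equals \<open>d\<close> in all
    branches but the last.\<close>
  have "0 \<le> (Smax - s) / ac" "0 \<le> ad * s"
    using assms by auto
  then show ?thesis
    using assms unfolding pi2_rule_def slot_feasible_def by (auto simp: max_def)
qed

lemma pi2_next_bounds:
  assumes "0 < ac" "0 < ad" "0 \<le> s" "s \<le> Smax"
  shows "0 \<le> pi2_next ac ad Gmax Smax s d" "pi2_next ac ad Gmax Smax s d \<le> Smax"
proof -
  have "s + ac * (Gmax + d) \<le> Smax" if "\<not> - Gmax + (Smax - s) / ac \<le> d"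
    using that assms by (simp add: field_simps)
  moreover have "0 \<le> s + ac * (Gmax + d)" if "- Gmax \<le> d"
    using that assms by simp
  moreover have "0 \<le> s + (Gmax + d) / ad" if "- Gmax - ad * s \<le> d"
    using that assms by (simp add: field_simps)
  moreover have "s + (Gmax + d) / ad \<le> Smax" if "\<not> - Gmax \<le> d"
    using that assms divide_nonpos_pos[of "Gmax + d" ad] by linarith
  ultimately show "0 \<le> pi2_next ac ad Gmax Smax s d" "pi2_next ac ad Gmax Smax s d \<le> Smax"
    using assms unfolding pi2_next_def by auto
qed

text \<open>More stored power only lowers the thresholds on \<open>d\<close>, and each branch value
  is nondecreasing in the stored power, so only the branch changes need a comparison.\<close>

lemma pi2_next_mono:
  assumes "0 < ac" "0 < ad" "0 \<le> Gmax" "0 \<le> s" "s \<le> t" "t \<le> Smax"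
  shows "pi2_next ac ad Gmax Smax s d \<le> pi2_next ac ad Gmax Smax t d"
proof (cases "- Gmax + (Smax - t) / ac \<le> d")
  case True
  then have "pi2_next ac ad Gmax Smax t d = Smax"
    by (simp add: pi2_next_def)
  then show ?thesis
    using pi2_next_bounds(2)[of ac ad s] assms by simp
next
  \<comment> \<open>Neither level gets filled now. The only possible branch change is that
    \<open>s\<close> is emptied while \<open>t\<close> is discharged, and then the value for
    \<open>t\<close> is still nonnegative.\<close>
  case False
  have "(Smax - t) / ac \<le> (Smax - s) / ac"
    using assms by (intro divide_right_mono) auto
  with False assms(3) have *: "\<not> - Gmax + (Smax - s) / ac \<le> d" "\<not> (Smax - s) / ac \<le> d"
      "\<not> (Smax - t) / ac \<le> d"
    by linarith+
  have "- Gmax - ad * t \<le> d" if "- Gmax - ad * s \<le> d"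
    using that assms mult_left_mono[of s t ad] by linarith
  moreover have "0 \<le> t + (Gmax + d) / ad" if "- Gmax - ad * t \<le> d"
    using that assms by (simp add: field_simps)
  ultimately show ?thesis
    using False * assms unfolding pi2_next_def by auto
qed

text \<open>Since \<open>ac < 1 < 1 / ad\<close>, the storage gain of \<open>(C, D)\<close> is at
  most both \<open>ac * (C - D)\<close> and \<open>(C - D) / ad\<close>. The first bound is sharp
  for pure charging, the second for pure discharging, and the power balance bounds
  \<open>C - D\<close>. The hypothesis \<open>le\<close> is the capacity constraint of the following
  slot.\<close>

lemma feasible_next_le_pi2_next:
  assumes "0 < ac" "ac < 1" "0 < ad" "ad < 1"
    and feas: "slot_feasible ad Gmax Smax s d (G, C, D)"
    and le: "s + ac * C - (1 / ad) * D \<le> Smax"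
  shows "s + ac * C - (1 / ad) * D \<le> pi2_next ac ad Gmax Smax s d"
proof -
  have CD: "0 \<le> C" "0 \<le> D" "0 \<le> s" and G: "G \<le> Gmax"
    and bal: "C - D \<le> G + max d (- Gmax - ad * s)"
    using feas by (auto simp: slot_feasible_def)
  have s: "0 \<le> ad * s"
    using CD assms by simp
  have ad1: "1 \<le> 1 / ad"
    using assms by simp
  have charge: "ac * C - (1 / ad) * D \<le> ac * (C - D)"
    using mult_right_mono[of ac "1 / ad" D] ad1 assms CD by (simp add: algebra_simps)
  have discharge: "ac * C - (1 / ad) * D \<le> (C - D) / ad"
    using mult_right_mono[of ac "1 / ad" C] ad1 assms CD by (simp add: diff_divide_distrib)
  have "s + ac * C - (1 / ad) * D \<le> s + ac * (Gmax + d)" if "- Gmax \<le> d"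
  proof -
    have "C - D \<le> Gmax + d"
      using that bal G s by (auto simp: max_def split: if_splits)
    then have "ac * (C - D) \<le> ac * (Gmax + d)"
      using assms by simp
    then show ?thesis
      using charge by linarith
  qed
  moreover have "s + ac * C - (1 / ad) * D \<le> s + (Gmax + d) / ad" if "- Gmax - ad * s \<le> d"
  proof -
    have "C - D \<le> Gmax + d"
      using that bal G by simp
    then have "(C - D) / ad \<le> (Gmax + d) / ad"
      using assms by (simp add: divide_right_mono)
    then show ?thesis
      using discharge by linarith
  qed
  \<comment> \<open>Loss of load: the maximum is \<open>- Gmax - ad * s\<close>, so even full
    generation leaves a net discharge of at least \<open>ad * s\<close>, which drains
    \<open>s\<close>.\<close>
  moreover have "s + ac * C - (1 / ad) * D \<le> 0" if "\<not> - Gmax - ad * s \<le> d"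
  proof -
    have "C - D \<le> - (ad * s)"
      using that bal G by simp
    then have "(C - D) / ad \<le> - (ad * s) / ad"
      using assms by (intro divide_right_mono) auto
    then show ?thesis
      using discharge assms by simp
  qed
  \<comment> \<open>The two branches with value \<open>Smax\<close> are settled by
    \<open>le\<close>.\<close>
  ultimately show ?thesis
    using le unfolding pi2_next_def by auto
qed

section \<open>Trajectories: pathwise domination by \<open>pi2\<close>\<close>

lemma controls_pi2:
  assumes "i \<ge> 1"
  shows "controls ac ad s1 (pi2 ac ad Gmax Smax) \<delta> i =
    pi2_rule ac ad Gmax Smax (stored ac ad s1 (pi2 ac ad Gmax Smax) \<delta> i) (\<delta> i)"
  using assms by (simp add: controls_def pi2_def stationary_def)

lemma stored_pi2_Suc:
  assumes "0 < ac" "0 < ad" "i \<ge> 1"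
  shows "stored ac ad s1 (pi2 ac ad Gmax Smax) \<delta> (Suc i) =
    pi2_next ac ad Gmax Smax (stored ac ad s1 (pi2 ac ad Gmax Smax) \<delta> i) (\<delta> i)"
  by (simp only: stored_Suc[OF assms(3)] controls_pi2[OF assms(3)] pi2_rule_next[OF assms(1,2)])

lemma stored_pi2_bounds:
  assumes "0 < ac" "0 < ad" "0 \<le> s1" "s1 \<le> Smax" "i \<ge> 1"
  shows "0 \<le> stored ac ad s1 (pi2 ac ad Gmax Smax) \<delta> i
    \<and> stored ac ad s1 (pi2 ac ad Gmax Smax) \<delta> i \<le> Smax"
  using assms(5)
proof (induction i rule: nat_induct_at_least)
  case base
  then show ?case
    using assms by (simp only: stored_1)
next
  case (Suc i)
  then show ?case
    using pi2_next_bounds assms by (simp add: stored_pi2_Suc)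
qed

lemma stored_le_stored_pi2:
  assumes "0 < ac" "ac < 1" "0 < ad" "ad < 1" "0 \<le> Gmax" "0 \<le> s1" "s1 \<le> Smax"
    and feas: "\<And>i. i \<ge> 1 \<Longrightarrow>
      slot_feasible ad Gmax Smax (stored ac ad s1 \<pi> \<delta> i) (\<delta> i) (controls ac ad s1 \<pi> \<delta> i)"
    and "i \<ge> 1"
  shows "stored ac ad s1 \<pi> \<delta> i \<le> stored ac ad s1 (pi2 ac ad Gmax Smax) \<delta> i"
  using \<open>i \<ge> 1\<close>
proof (induction i rule: nat_induct_at_least)
  case base
  then show ?case
    by (simp only: stored_1 order_refl)
next
  case (Suc i)
  \<comment> \<open>\<open>slot_feasible\<close> constrains only the current level, so the capacity
    bound on the next level is taken from feasibility of slot \<open>Suc i\<close>.\<close>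
  have bounds: "0 \<le> stored ac ad s1 \<pi> \<delta> j \<and> stored ac ad s1 \<pi> \<delta> j \<le> Smax" if "j \<ge> 1" for j
    using feas[OF that] by (auto simp: slot_feasible_def split: prod.splits)
  obtain G C D where c: "controls ac ad s1 \<pi> \<delta> i = (G, C, D)"
    by (cases "controls ac ad s1 \<pi> \<delta> i")
  have eq: "stored ac ad s1 \<pi> \<delta> (Suc i) = stored ac ad s1 \<pi> \<delta> i + ac * C - (1 / ad) * D"
    using stored_Suc[OF Suc.hyps] c by simp
  have "stored ac ad s1 \<pi> \<delta> (Suc i) \<le> pi2_next ac ad Gmax Smax (stored ac ad s1 \<pi> \<delta> i) (\<delta> i)"
    using feasible_next_le_pi2_next[OF assms(1-4)] feas[OF Suc.hyps] bounds[of "Suc i"]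
    unfolding c eq by simp
  also have "\<dots> \<le> pi2_next ac ad Gmax Smax (stored ac ad s1 (pi2 ac ad Gmax Smax) \<delta> i) (\<delta> i)"
    using Suc bounds[OF Suc.hyps] stored_pi2_bounds[OF assms(1,3,6,7) Suc.hyps] assms(1,3,5)
    by (intro pi2_next_mono) simp_all
  also have "\<dots> = stored ac ad s1 (pi2 ac ad Gmax Smax) \<delta> (Suc i)"
    using stored_pi2_Suc[OF assms(1,3) Suc.hyps] by simp
  finally show ?case .
qed

section \<open>Measurability and comparison of expected costs\<close>

lemma stored_measurable:
  assumes \<Delta>: "\<And>i. i \<ge> 1 \<Longrightarrow> \<Delta> i \<in> borel_measurable M"
    and \<pi>: "\<And>i. i \<ge> 1 \<Longrightarrow> (\<lambda>(s, d). \<pi> i s d)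
        \<in> borel_measurable ((\<Pi>\<^sub>M j\<in>{1..i}. borel) \<Otimes>\<^sub>M (\<Pi>\<^sub>M j\<in>{1..i}. borel))"
  shows "(\<lambda>\<omega>. stored ac ad s1 \<pi> (\<lambda>j. \<Delta> j \<omega>) i) \<in> borel_measurable M"
\<comment> \<open>Strong induction, because the controls may depend on all earlier stored
  powers.\<close>
proof (induction i rule: less_induct)
  case (less i)
  show ?case
  proof (cases "i \<le> 1")
    case True
    then show ?thesis
      by (subst stored.simps) simp
  next
    case False
    then obtain k where k: "i = Suc k" "k \<ge> 1"
      by (cases i) auto
    have [measurable]: "(\<lambda>\<omega>. stored ac ad s1 \<pi> (\<lambda>j. \<Delta> j \<omega>) k) \<in> borel_measurable M"
      using less k by simp
    have "(\<lambda>\<omega>. (\<lambda>(s, d). \<pi> k s d) (\<lambda>j\<in>{1..k}. stored ac ad s1 \<pi> (\<lambda>j. \<Delta> j \<omega>) j, \<lambda>j\<in>{1..k}. \<Delta> j \<omega>))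
        \<in> borel_measurable M"
      by (intro measurable_compose[OF _ \<pi>[OF k(2)]] measurable_Pair measurable_restrict \<Delta> less)
        (auto simp: k)
    then have "(\<lambda>\<omega>. controls ac ad s1 \<pi> (\<lambda>j. \<Delta> j \<omega>) k) \<in> measurable M borel"
      by (simp add: controls_def)
    \<comment> \<open>Viewing the Borel space of triples as a product makes the projections to
      \<open>C\<close> and \<open>D\<close> measurable.\<close>
    then have [measurable]: "(\<lambda>\<omega>. controls ac ad s1 \<pi> (\<lambda>j. \<Delta> j \<omega>) k)
        \<in> measurable M (borel \<Otimes>\<^sub>M (borel \<Otimes>\<^sub>M borel))"
      by (simp add: borel_prod)
    have "(\<lambda>\<omega>. stored ac ad s1 \<pi> (\<lambda>j. \<Delta> j \<omega>) k
          + ac * fst (snd (controls ac ad s1 \<pi> (\<lambda>j. \<Delta> j \<omega>) k))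
          - (1 / ad) * snd (snd (controls ac ad s1 \<pi> (\<lambda>j. \<Delta> j \<omega>) k))) \<in> borel_measurable M"
      by measurable
    then show ?thesis
      unfolding k(1) stored_Suc[OF k(2)] by (simp add: case_prod_beta)
  qed
qed

lemma pi2_measurable:
  assumes "i \<ge> 1"
  shows "(\<lambda>(s, d). pi2 ac ad Gmax Smax i s d)
    \<in> borel_measurable ((\<Pi>\<^sub>M j\<in>{1..i}. borel) \<Otimes>\<^sub>M (\<Pi>\<^sub>M j\<in>{1..i}. borel))"
proof -
  have i: "i \<in> {1..i}"
    using assms by simp
  let ?N = "(\<Pi>\<^sub>M j\<in>{1..i}. (borel :: real measure)) \<Otimes>\<^sub>M (\<Pi>\<^sub>M j\<in>{1..i}. (borel :: real measure))"
  have [measurable]: "(\<lambda>x. fst x i) \<in> borel_measurable ?N" "(\<lambda>x. snd x i) \<in> borel_measurable ?N"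
    by (rule measurable_compose[OF measurable_fst measurable_component_singleton[OF i]],
        rule measurable_compose[OF measurable_snd measurable_component_singleton[OF i]])
  show ?thesis
    unfolding pi2_def stationary_def pi2_rule_def case_prod_beta borel_prod[symmetric] by measurable
qed

text \<open>Turns almost sure domination of stored power into an order of costs: the loss indicator
  is antitone in the stored power, and expectation and limsup preserve inequalities.\<close>

lemma J_L_mono:
  assumes "prob_space M"
    and \<Delta>: "\<And>i. i \<ge> 1 \<Longrightarrow> \<Delta> i \<in> borel_measurable M"
    and meas: "\<And>i. (\<lambda>\<omega>. stored ac ad s1 \<pi> (\<lambda>j. \<Delta> j \<omega>) i) \<in> borel_measurable M"
      "\<And>i. (\<lambda>\<omega>. stored ac ad s1 \<pi>' (\<lambda>j. \<Delta> j \<omega>) i) \<in> borel_measurable M"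
    and le: "AE \<omega> in M. \<forall>i\<ge>1. stored ac ad s1 \<pi>' (\<lambda>j. \<Delta> j \<omega>) i \<le> stored ac ad s1 \<pi> (\<lambda>j. \<Delta> j \<omega>) i"
    and "0 < ad"
  shows "J_L M \<Delta> ac ad Gmax \<pi> s1 \<le> J_L M \<Delta> ac ad Gmax \<pi>' s1"
proof -
  interpret prob_space M by fact
  define loss :: "policy \<Rightarrow> nat \<Rightarrow> 'a \<Rightarrow> real" where
    "loss \<rho> i \<omega> = of_bool (\<Delta> i \<omega> < - Gmax - ad * stored ac ad s1 \<rho> (\<lambda>j. \<Delta> j \<omega>) i)" for \<rho> i \<omega>
  \<comment> \<open>Monotonicity of the Bochner integral needs both sides integrable; here the
    indicators are measurable and bounded by 1 on a probability space.\<close>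
  have int: "integrable M (\<lambda>\<omega>. (1 / real n) * (\<Sum>i=1..n. loss \<rho> i \<omega>))"
    if "\<rho> = \<pi> \<or> \<rho> = \<pi>'" for \<rho> n
  proof (rule integrable_mult_right, rule Bochner_Integration.integrable_sum)
    fix i assume "i \<in> {1..n}"
    then have [measurable]: "\<Delta> i \<in> borel_measurable M"
        "(\<lambda>\<omega>. stored ac ad s1 \<rho> (\<lambda>j. \<Delta> j \<omega>) i) \<in> borel_measurable M"
      using \<Delta> meas that by auto
    show "integrable M (loss \<rho> i)"
      unfolding loss_def by (rule integrable_const_bound[where B = 1]) (auto, measurable)
  qed
  have "(\<integral>\<omega>. (1 / real n) * (\<Sum>i=1..n. loss \<pi> i \<omega>) \<partial>M)
      \<le> (\<integral>\<omega>. (1 / real n) * (\<Sum>i=1..n. loss \<pi>' i \<omega>) \<partial>M)" for n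
  proof (rule integral_mono_AE[OF int int])
    show "AE \<omega> in M. (1 / real n) * (\<Sum>i=1..n. loss \<pi> i \<omega>) \<le> (1 / real n) * (\<Sum>i=1..n. loss \<pi>' i \<omega>)"
      using le
    proof eventually_elim
      case (elim \<omega>)
      have "loss \<pi> i \<omega> \<le> loss \<pi>' i \<omega>" if "i \<in> {1..n}" for i
      proof -
        have "ad * stored ac ad s1 \<pi>' (\<lambda>j. \<Delta> j \<omega>) i \<le> ad * stored ac ad s1 \<pi> (\<lambda>j. \<Delta> j \<omega>) i"
          using elim that \<open>0 < ad\<close> by simp
        then show ?thesis
          unfolding loss_def by simp
      qed
      then show ?case
        by (intro mult_left_mono sum_mono) auto
    qed
  qed auto
  then show ?thesis
    unfolding J_L_def loss_def by (intro Limsup_mono always_eventually) auto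
qed

theorem theorem2:
  fixes M :: "'w measure" and \<Delta> :: "nat \<Rightarrow> 'w \<Rightarrow> real"
    and ac ad Gmax Smax s1 :: real
  assumes "prob_space M"
    and "\<And>i. i \<ge> 1 \<Longrightarrow> \<Delta> i \<in> borel_measurable M"
    and "0 < ac" "ac < 1" "0 < ad" "ad < 1"
    and "0 \<le> Gmax" "0 \<le> Smax"
    and "0 \<le> s1" "s1 \<le> Smax"
  shows "admissible M \<Delta> ac ad Gmax Smax s1 (pi2 ac ad Gmax Smax)
    \<and> (\<forall>\<pi>. admissible M \<Delta> ac ad Gmax Smax s1 \<pi> \<longrightarrow>
          J_L M \<Delta> ac ad Gmax (pi2 ac ad Gmax Smax) s1 \<le> J_L M \<Delta> ac ad Gmax \<pi> s1)
    \<and> (\<forall>\<omega>\<in>space M. \<forall>i\<ge>1.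
          stored ac ad s1 (pi2 ac ad Gmax Smax) (\<lambda>j. \<Delta> j \<omega>) (Suc i) =
          pi2_next ac ad Gmax Smax
            (stored ac ad s1 (pi2 ac ad Gmax Smax) (\<lambda>j. \<Delta> j \<omega>) i) (\<Delta> i \<omega>))"
proof (intro conjI allI impI ballI)
  let ?pi2 = "pi2 ac ad Gmax Smax"
  have "slot_feasible ad Gmax Smax (stored ac ad s1 ?pi2 \<delta> i) (\<delta> i) (controls ac ad s1 ?pi2 \<delta> i)"
    if "i \<ge> 1" for \<delta> i
    using assms that stored_pi2_bounds by (simp add: controls_pi2 pi2_rule_feasible)
  then show adm: "admissible M \<Delta> ac ad Gmax Smax s1 ?pi2"
    unfolding admissible_def using pi2_measurable by (intro conjI allI impI always_eventually) blast+
  fix \<pi> assume adm': "admissible M \<Delta> ac ad Gmax Smax s1 \<pi>"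
  have meas: "(\<lambda>\<omega>. stored ac ad s1 \<rho> (\<lambda>j. \<Delta> j \<omega>) i) \<in> borel_measurable M"
    if "admissible M \<Delta> ac ad Gmax Smax s1 \<rho>" for \<rho> i
    using that assms(2) by (intro stored_measurable) (auto simp: admissible_def)
  have "AE \<omega> in M. \<forall>i\<ge>1. slot_feasible ad Gmax Smax (stored ac ad s1 \<pi> (\<lambda>j. \<Delta> j \<omega>) i) (\<Delta> i \<omega>)
      (controls ac ad s1 \<pi> (\<lambda>j. \<Delta> j \<omega>) i)"
    using adm' by (simp add: admissible_def)
  \<comment> \<open>Domination concerns a single realization, so it holds off the one null set where
    \<open>\<pi>\<close> violates a constraint in some slot.\<close>
  then have "AE \<omega> in M. \<forall>i\<ge>1.
      stored ac ad s1 \<pi> (\<lambda>j. \<Delta> j \<omega>) i \<le> stored ac ad s1 ?pi2 (\<lambda>j. \<Delta> j \<omega>) i"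
    by eventually_elim (use assms stored_le_stored_pi2 in blast)
  then show "J_L M \<Delta> ac ad Gmax ?pi2 s1 \<le> J_L M \<Delta> ac ad Gmax \<pi> s1"
    using assms by (intro J_L_mono meas adm adm') auto
qed (rule stored_pi2_Suc[OF assms(3,5)])

end
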